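(* Let $n\in\mathbb{N}$, let $(\bar r_k)_{k=1}^\infty$ be a sequence of $n$-tuples $\bar r_k=(r_k^{(1)},\ldots,r_k^{(n)})$ of positive numbers that decays $(X,\rho,H,L,\mathbf F)$-fast, and let $f\in C(X)$. Suppose $\bar x=(x^{(1)},\ldots,x^{(n)})$ is an $n$-tuple in $X$ such that $$\lim_{k\to\infty}\operatorname{Avg}_{F_k}f\left(x^{(h)}\right)=C\qquad(\forall h\in\{1,\ldots,n\}),$$ where $C$ is independent of $h$, and let $\mu$ be a Borel probability measure on $X$ for which $x^{(1)},\ldots,x^{(n)}\in\operatorname{supp}(\mu)$. Then $$\lim_{k\to\infty}\alpha_{B(\bar x;\bar r_k)}\left(\operatorname{Avg}_{F_k}f\right)=C.$$
   Context: $(X,\rho)$ is a compact metric space and $C(X)$ is the space of continuous functions $X\to\mathbb{C}$. $G$ is a discrete group and $T:G\curvearrowright X$ is a left action by homeomorphisms $(T_g)_{g\in G}$ ($T_{g_1}\circ T_{g_2}=T_{g_1g_2}$, $T_{1_G}=\mathrm{id}_X$) which are Hölder with modulus of Hölder continuity $(H,L)$: $H,L:G\to(0,\infty)$ are functions with $\rho(T_gx,T_gy)\le L(g)\cdot\rho(x,y)^{H(g)}$ for all $g\in G$, $x,y\in X$. $\mathbf F=(F_k)_{k=1}^\infty$ is a sequence of nonempty finite subsets of $G$. For a finite nonempty $F\subseteq G$ and $f:X\to\mathbb{C}$, $\operatorname{Avg}_Ff:=\frac1{|F|}\sum_{g\in F}f\circ T_g$. For $x\in X,r>0$, $B(x;r)=\{y\in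 X:\rho(x,y)<r\}$; for $\bar x\in X^n$, $\bar r\in(0,\infty)^n$, $B(\bar x;\bar r):=\bigcup_{h=1}^nB(x^{(h)};r^{(h)})$ (a multi-ball). For a measurable $E\subseteq X$ with $\mu(E)>0$, $\alpha_E(f):=\frac1{\mu(E)}\int_Ef\,\mathrm d\mu$. A sequence $(\bar r_k)_{k=1}^\infty$ of $n$-tuples of positive numbers decays $(X,\rho,H,L,\mathbf F)$-fast if for all $h\in\{1,\ldots,n\}$ we have $\lim_{k\to\infty}r_k^{(h)}=0$ and, for all $\delta\in(0,\infty)$, $\lim_{k\to\infty}\frac{|\{g\in F_k:L(g)\cdot(r_k^{(h)})^{H(g)}>\delta\}|}{|F_k|}=0$. *)

theory Defs
  imports
    "HOL-Algebra.Group_Action"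
    "HOL-Probability.Probability_Measure"
begin

text \<open>
  The compact space is a whole type of class \<open>metric_space\<close>. The locale \<open>group_action\<close> says that
  \<open>T\<close> is a homomorphism from \<open>G\<close> into the group of bijections of that type under composition,
  so it is a left action. The group is discrete: no topology is put on it.
\<close>

locale hoelder_action = group_action G "UNIV :: 'a :: metric_space set" T
  for G (structure) and T +
  fixes H L :: "_ \<Rightarrow> real"
  assumes homeo: "g \<in> carrier G \<Longrightarrow> homeomorphic_map euclidean euclidean (T g)"
    and H_pos: "g \<in> carrier G \<Longrightarrow> 0 < H g"
    and L_pos: "g \<in> carrier G \<Longrightarrow> 0 < L g"
    and hoelder: "g \<in> carrier G \<Longrightarrow> dist (T g x) (T g y) \<le> L g * dist x y powr H g"

definition Avg :: "('g \<Rightarrow> 'a \<Rightarrow> 'a) \<Rightarrow> 'g set \<Rightarrow> ('a \<Rightarrow> complex) \<Rightarrow> 'a \<Rightarrow> complex" where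
  "Avg T F f = (\<lambda>x. (1 / of_nat (card F)) * (\<Sum>g\<in>F. (f \<circ> T g) x))"

text \<open>An \<open>n\<close>-tuple is a function on \<open>nat\<close> of which only the values at \<open>1, \<dots>, n\<close> are used.\<close>

definition multi_ball :: "nat \<Rightarrow> (nat \<Rightarrow> 'a :: metric_space) \<Rightarrow> (nat \<Rightarrow> real) \<Rightarrow> 'a set" where
  "multi_ball n x r = (\<Union>h\<in>{1..n}. ball (x h) (r h))"

text \<open>Only meaningful for measurable \<open>E\<close> of positive measure; it is \<open>0\<close> on null sets.\<close>

definition set_average :: "'a measure \<Rightarrow> 'a set \<Rightarrow> ('a \<Rightarrow> complex) \<Rightarrow> complex" where
  "set_average \<mu> E f = (1 / measure \<mu> E) *\<^sub>R (LINT y:E|\<mu>. f y)"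

definition measure_support :: "'a :: topological_space measure \<Rightarrow> 'a set" where
  "measure_support \<mu> = {x. \<forall>U. open U \<longrightarrow> x \<in> U \<longrightarrow> 0 < emeasure \<mu> U}"

text \<open>Here \<open>r k h\<close> is the \<open>h\<close>-th entry of the \<open>k\<close>-th tuple.\<close>

definition decays_fast ::
    "('g \<Rightarrow> real) \<Rightarrow> ('g \<Rightarrow> real) \<Rightarrow> (nat \<Rightarrow> 'g set) \<Rightarrow> nat \<Rightarrow> (nat \<Rightarrow> nat \<Rightarrow> real) \<Rightarrow> bool" where
  "decays_fast H L F n r \<longleftrightarrow>
     (\<forall>h\<in>{1..n}.
        (\<lambda>k. r k h) \<longlonglongrightarrow> 0 \<and>
        (\<forall>\<delta>>0. (\<lambda>k. real (card {g \<in> F k. L g * r k h powr H g > \<delta>}) / real (card (F k)))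
                  \<longlonglongrightarrow> 0))"

end

theory Submission
  imports Defs
begin

text \<open>
  On a ball of radius \<open>r\<close> about \<open>x\<close>, all group elements \<open>g\<close> with \<open>L g * r powr H g\<close> small move the
  whole ball uniformly close to \<open>T g x\<close>, where uniform continuity of \<open>f\<close> applies; the other elements
  have vanishing proportion in \<open>F k\<close> and contribute at most twice the sup norm of \<open>f\<close> each. Hence
  \<open>Avg\<close> is uniformly close to \<open>C\<close> on the multi-balls, and so is its mean over them.
\<close>

text \<open>Averaging over a set of positive finite measure is linear and fixes constants, so the
  difference is the mean of \<open>f - c\<close>; the norm then passes inside the integral.\<close>

lemma norm_set_average_diff_le:
  fixes f :: "'a \<Rightarrow> complex"
  assumes "finite_measure \<mu>" and E: "E \<in> sets \<mu>" and pos: "0 < measure \<mu> E"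
    and int: "set_integrable \<mu> E f"
    and bound: "\<And>y. y \<in> E \<Longrightarrow> norm (f y - c) \<le> \<epsilon>"
  shows "norm (set_average \<mu> E f - c) \<le> \<epsilon>"
proof -
  interpret finite_measure \<mu> by fact
  \<comment> \<open>Polymorphic, since it serves both the complex \<open>c\<close> and the real
    bound \<open>\<epsilon>\<close>.\<close>
  have const: "set_integrable \<mu> E (\<lambda>_. a)" for a :: "'b :: {banach, second_countable_topology}"
    using E by (simp add: set_integrable_def less_top[symmetric])
  have const_eq: "(LINT y:E|\<mu>. a) = measure \<mu> E *\<^sub>R a" for a :: "'b :: {banach, second_countable_topology}"
    using E by (intro set_integral_const) auto
  have diff: "set_integrable \<mu> E (\<lambda>y. f y - c)"
    using int const by (rule set_integral_diff)
  have "set_average \<mu> E f - c = (1 / measure \<mu> E) *\<^sub>R (LINT y:E|\<mu>. f y - c)"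
    using pos by (simp add: set_average_def set_integral_diff(2)[OF int const] const_eq
        scaleR_diff_right)
  moreover have "norm (LINT y:E|\<mu>. f y - c) \<le> (LINT y:E|\<mu>. norm (f y - c))"
    by (rule set_integral_norm_bound[OF diff])
  moreover have "\<dots> \<le> (LINT y:E|\<mu>. \<epsilon>)"
    using diff const bound by (intro set_integral_mono set_integrable_norm) auto
  ultimately show ?thesis
    using pos by (simp add: const_eq divide_le_eq mult.commute)
qed

lemma (in hoelder_action) continuous_on_Avg:
  assumes "F \<subseteq> carrier G" and "continuous_on UNIV f"
  shows "continuous_on UNIV (Avg T F f)"
proof -
  have "continuous_on UNIV (T g)" if "g \<in> F" for g
    using homeo[of g] that assms(1) homeomorphic_imp_continuous_map by fastforce
  then have "continuous_on UNIV (\<lambda>y. f (T g y))" if "g \<in> F" for g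
    using continuous_on_compose2[OF assms(2)] that by blast
  then show ?thesis
    unfolding Avg_def comp_def by (intro continuous_intros)
qed

text \<open>Isolates the estimate for one fixed \<open>F\<close> and one fixed radius from the
  passage to the limit: the quotient in the bound is the one that \<open>decays_fast\<close> sends
  to 0.\<close>

lemma (in hoelder_action) norm_Avg_diff_le:
  assumes F: "F \<subseteq> carrier G" "finite F" "F \<noteq> {}"
    and M: "\<And>y. norm (f y) \<le> M"
    and unif: "\<And>y z. dist y z \<le> \<delta> \<Longrightarrow> norm (f y - f z) \<le> \<epsilon>"
    and y: "dist y x \<le> r" and "0 \<le> \<epsilon>"
  shows "norm (Avg T F f y - Avg T F f x)
    \<le> \<epsilon> + 2 * M * (real (card {g \<in> F. L g * r powr H g > \<delta>}) / real (card F))"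
proof -
  let ?B = "{g \<in> F. L g * r powr H g > \<delta>}"
  have M0: "0 \<le> M" using M norm_ge_zero order_trans by blast
  have summand: "norm (f (T g y) - f (T g x)) \<le> \<epsilon> + (if g \<in> ?B then 2 * M else 0)" if g: "g \<in> F" for g
  proof (cases "g \<in> ?B")
    case True
    have "norm (f (T g y) - f (T g x)) \<le> 2 * M"
      using norm_triangle_ineq4[of "f (T g y)" "f (T g x)"] M[of "T g y"] M[of "T g x"] by linarith
    with True \<open>0 \<le> \<epsilon>\<close> show ?thesis by simp
  next
    case False
    have gG: "g \<in> carrier G" using g F by blast
    have "dist (T g y) (T g x) \<le> L g * dist y x powr H g" by (rule hoelder[OF gG])
    \<comment> \<open>A positive exponent makes \<open>powr\<close> monotone in the base, so the
      radius may replace the distance.\<close>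
    also have "\<dots> \<le> L g * r powr H g"
      using y H_pos[OF gG] L_pos[OF gG] by (intro mult_left_mono powr_mono2) auto
    also have "\<dots> \<le> \<delta>" using False g by auto
    finally show ?thesis using unif False by auto
  qed
  have "Avg T F f y - Avg T F f x = (\<Sum>g\<in>F. f (T g y) - f (T g x)) / of_nat (card F)"
    by (simp add: Avg_def sum_subtractf diff_divide_distrib)
  then have "norm (Avg T F f y - Avg T F f x) = norm (\<Sum>g\<in>F. f (T g y) - f (T g x)) / real (card F)"
    by (simp add: norm_divide)
  also have "\<dots> \<le> (\<Sum>g\<in>F. \<epsilon> + (if g \<in> ?B then 2 * M else 0)) / real (card F)"
    using summand by (intro divide_right_mono sum_norm_le) auto
  also have "(\<Sum>g\<in>F. \<epsilon> + (if g \<in> ?B then 2 * M else 0)) = real (card F) * \<epsilon> + 2 * M * real (card ?B)"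
    using F(2) by (simp add: sum.distrib flip: sum.inter_filter)
  finally show ?thesis
    using F by (simp add: add_divide_distrib)
qed

theorem theorem2p7:
  fixes G :: "('g, 'b) monoid_scheme"
    and T :: "'g \<Rightarrow> 'a :: metric_space \<Rightarrow> 'a"
    and H L :: "'g \<Rightarrow> real"
    and F :: "nat \<Rightarrow> 'g set"
    and n :: nat
    and r :: "nat \<Rightarrow> nat \<Rightarrow> real"
    and f :: "'a \<Rightarrow> complex"
    and x :: "nat \<Rightarrow> 'a"
    and C :: complex
    and \<mu> :: "'a measure"
  assumes "compact (UNIV :: 'a set)"
    and "hoelder_action G T H L"
    and "\<And>k. k \<ge> 1 \<Longrightarrow> F k \<subseteq> carrier G \<and> finite (F k) \<and> F k \<noteq> {}"
    and "n \<ge> 1"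
    and "\<And>k h. k \<ge> 1 \<Longrightarrow> h \<in> {1..n} \<Longrightarrow> 0 < r k h"
    and "decays_fast H L F n r"
    and "continuous_on UNIV f"
    and "\<And>h. h \<in> {1..n} \<Longrightarrow> (\<lambda>k. Avg T (F k) f (x h)) \<longlonglongrightarrow> C"
    and "prob_space \<mu>"
    and "sets \<mu> = sets borel"
    and "\<And>h. h \<in> {1..n} \<Longrightarrow> x h \<in> measure_support \<mu>"
  shows "(\<lambda>k. set_average \<mu> (multi_ball n x (r k)) (Avg T (F k) f)) \<longlonglongrightarrow> C"
proof (rule LIMSEQ_I)
  fix \<epsilon> :: real
  assume "0 < \<epsilon>"
  interpret hoelder_action G T H L by fact
  interpret prob_space \<mu> by fact
  have "bounded (range f)"
    using assms(1,7) by (intro compact_imp_bounded compact_continuous_image)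
  then obtain M where M: "norm (f y) \<le> M" for y
    unfolding bounded_iff by auto
  obtain d where "0 < d" and d: "dist y z < d \<Longrightarrow> dist (f y) (f z) < \<epsilon> / 4" for y z
    using compact_uniformly_continuous[OF assms(7,1)] \<open>0 < \<epsilon>\<close>
    unfolding uniformly_continuous_on_def by (metis UNIV_I divide_pos_pos zero_less_numeral)
  \<comment> \<open>Halving \<open>d\<close> turns the strict bound of uniform continuity into the
    non-strict form that \<open>norm_Avg_diff_le\<close> takes; hence the threshold
    \<open>d / 2\<close> in \<open>q\<close>.\<close>
  have unif: "norm (f y - f z) \<le> \<epsilon> / 4" if "dist y z \<le> d / 2" for y z
    using d[of y z] that \<open>0 < d\<close> by (simp add: dist_norm)
  define q where "q k h = real (card {g \<in> F k. L g * r k h powr H g > d / 2}) / real (card (F k))"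
    for k h
  \<comment> \<open>One range of \<open>k\<close> serves all \<open>h\<close> because there are
    finitely many. This \<open>\<epsilon> / 4\<close> covers the error at the centres and the
    exceptional group elements; another \<open>\<epsilon> / 4\<close> comes from
    \<open>unif\<close>.\<close>
  have ev: "\<forall>\<^sub>F k in sequentially. \<forall>h\<in>{1..n}. norm (Avg T (F k) f (x h) - C) + 2 * M * q k h < \<epsilon> / 4"
  proof (intro eventually_ball_finite ballI)
    fix h assume h: "h \<in> {1..n}"
    have "(\<lambda>k. q k h) \<longlonglongrightarrow> 0"
      using assms(6) h half_gt_zero[OF \<open>0 < d\<close>] unfolding decays_fast_def q_def by blast
    then have "(\<lambda>k. norm (Avg T (F k) f (x h) - C) + 2 * M * q k h) \<longlonglongrightarrow> norm (C - C) + 2 * M * 0"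
      using assms(8)[OF h] by (intro tendsto_intros)
    then show "\<forall>\<^sub>F k in sequentially. norm (Avg T (F k) f (x h) - C) + 2 * M * q k h < \<epsilon> / 4"
      using \<open>0 < \<epsilon>\<close> by (intro order_tendstoD(2)) auto
  qed simp
  have "\<forall>\<^sub>F k in sequentially.
    norm (set_average \<mu> (multi_ball n x (r k)) (Avg T (F k) f) - C) < \<epsilon>"
    \<comment> \<open>The assumptions on \<open>F k\<close> and \<open>r k\<close> start at
      \<open>k = 1\<close>.\<close>
    using ev eventually_ge_at_top[of 1]
  proof eventually_elim
    case (elim k)
    let ?E = "multi_ball n x (r k)"
    have Fk: "F k \<subseteq> carrier G" "finite (F k)" "F k \<noteq> {}"
      using assms(3) elim(2) by auto
    have "open ?E" unfolding multi_ball_def by auto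
    then have E: "?E \<in> sets \<mu>" using assms(10) by simp
    \<comment> \<open>Since \<open>n \<ge> 1\<close>, the open set \<open>?E\<close> contains the
      support point \<open>x 1\<close>. Positive measure rules out the default value 0 of
      \<open>set_average\<close>.\<close>
    have "0 < emeasure \<mu> ?E"
    proof -
      have "x 1 \<in> ?E"
        using assms(4,5) elim(2) unfolding multi_ball_def by force
      then show ?thesis
        using assms(11)[of 1] assms(4) \<open>open ?E\<close> unfolding measure_support_def by auto
    qed
    then have pos: "0 < measure \<mu> ?E" by (simp add: emeasure_eq_measure)
    \<comment> \<open>Continuity gives Borel measurability and, by compactness, boundedness;
      together they give integrability over a probability space.\<close>
    have cont: "continuous_on UNIV (Avg T (F k) f)"
      using Fk(1) assms(7) by (rule continuous_on_Avg)
    then have "bounded (range (Avg T (F k) f))"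
      using assms(1) by (intro compact_imp_bounded compact_continuous_image)
    then obtain N where "norm (Avg T (F k) f y) \<le> N" for y
      unfolding bounded_iff by auto
    moreover have "Avg T (F k) f \<in> borel_measurable \<mu>"
      using borel_measurable_continuous_onI[OF cont] measurable_cong_sets[OF assms(10) refl] by blast
    ultimately have "integrable \<mu> (Avg T (F k) f)"
      by (intro integrable_const_bound[where B = N]) auto
    then have int: "set_integrable \<mu> ?E (Avg T (F k) f)"
      unfolding set_integrable_def by (rule integrable_mult_indicator[OF E])
    \<comment> \<open>The bound is pointwise, with \<open>h\<close> chosen for each
      \<open>y\<close>, so overlaps between the balls do no harm. Stopping at
      \<open>\<epsilon> / 2\<close> leaves room for the strict inequality in the limit.\<close>
    have "norm (Avg T (F k) f y - C) \<le> \<epsilon> / 2" if y: "y \<in> ?E" for y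
    proof -
      obtain h where h: "h \<in> {1..n}" "dist y (x h) \<le> r k h"
        using y unfolding multi_ball_def by (force simp: dist_commute)
      have "norm (Avg T (F k) f y - C)
        \<le> norm (Avg T (F k) f y - Avg T (F k) f (x h)) + norm (Avg T (F k) f (x h) - C)"
        using dist_triangle[of "Avg T (F k) f y" C "Avg T (F k) f (x h)"] by (simp add: dist_norm)
      also have "norm (Avg T (F k) f y - Avg T (F k) f (x h)) \<le> \<epsilon> / 4 + 2 * M * q k h"
        unfolding q_def using Fk M unif h(2) \<open>0 < \<epsilon>\<close> by (intro norm_Avg_diff_le) auto
      finally show ?thesis using elim(1) h(1) by fastforce
    qed
    then have "norm (set_average \<mu> ?E (Avg T (F k) f) - C) \<le> \<epsilon> / 2"
      using norm_set_average_diff_le finite_measure_axioms E pos int by blast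
    then show ?case using \<open>0 < \<epsilon>\<close> by simp
  qed
  then show "\<exists>K. \<forall>k\<ge>K. norm (set_average \<mu> (multi_ball n x (r k)) (Avg T (F k) f) - C) < \<epsilon>"
    by (simp add: eventually_sequentially)
qed

end
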